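(* Let $k>n\ge 1$ be integers. Consider the following game: a codemaker secretly chooses a vector $y=(y_1,\dots,y_n)\in\{1,\dots,k\}^n$ with pairwise distinct entries; a codebreaker repeatedly submits queries $x=(x_1,\dots,x_n)\in\{1,\dots,k\}^n$, each of which must also have pairwise distinct entries, and after each query receives the answer $\mathrm{black}(x,y)=|\{i\in\{1,\dots,n\}:x_i=y_i\}|$; queries may depend on previous answers. Then the codebreaker has a deterministic adaptive strategy that identifies the secret code $y$ (for every possible $y$) using at most $(n-1)\lceil\log_2 n\rceil+k+n-2$ queries.
   Context: This is the Black-Peg Mastermind variant with $k>n$ colors, $n$ positions, and no color repetition allowed in the secret code or in the queries; only the black information is returned. *)

theory Defs
  imports Complex_Main "HOL-Library.FuncSet"
begin

text \<open>Secret codes and queries are vectors indexed by \<open>{1..n}\<close>, hence extensional functions.\<close>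

definition codes :: "nat \<Rightarrow> nat \<Rightarrow> (nat \<Rightarrow> nat) set" where
  "codes n k = {x \<in> {1..n} \<rightarrow>\<^sub>E {1..k}. inj_on x {1..n}}"

definition black :: "nat \<Rightarrow> (nat \<Rightarrow> nat) \<Rightarrow> (nat \<Rightarrow> nat) \<Rightarrow> nat" where
  "black n x y = card {i \<in> {1..n}. x i = y i}"

text \<open>
  A deterministic adaptive strategy is a decision tree: \<open>Ask x f\<close> submits the query \<open>x\<close> and
  continues with \<open>f b\<close> on answer \<open>b\<close>; \<open>Identify x\<close> stops and declares the secret to be \<open>x\<close>.
  The declaration is not a query; in particular the secret itself need not have been queried.
\<close>

datatype strategy =
    Identify "nat \<Rightarrow> nat"
  | Ask "nat \<Rightarrow> nat" "nat \<Rightarrow> strategy"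

primrec legal :: "nat \<Rightarrow> nat \<Rightarrow> strategy \<Rightarrow> bool" where
  "legal n k (Identify x) \<longleftrightarrow> True"
| "legal n k (Ask x f) \<longleftrightarrow> x \<in> codes n k \<and> (\<forall>b. legal n k (f b))"

text \<open>The declared code and the number of queries when \<open>y\<close> is the secret; the strategy
  depends on \<open>y\<close> only through the answers.\<close>

primrec declared :: "nat \<Rightarrow> strategy \<Rightarrow> (nat \<Rightarrow> nat) \<Rightarrow> (nat \<Rightarrow> nat)" where
  "declared n (Identify x) y = x"
| "declared n (Ask x f) y = declared n (f (black n x y)) y"

primrec num_queries :: "nat \<Rightarrow> strategy \<Rightarrow> (nat \<Rightarrow> nat) \<Rightarrow> nat" where
  "num_queries n (Identify x) y = 0"
| "num_queries n (Ask x f) y = Suc (num_queries n (f (black n x y)) y)"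

end

theory Submission
  imports Defs
begin

text \<open>
  Take \<open>k\<close> cyclic shifts of a fixed arrangement of the colors, cut off after \<open>n\<close> positions.
  Every position agrees with the secret in exactly one shift, so the \<open>k\<close> answers sum to \<open>n\<close>; hence
  \<open>k - 1\<close> queries reveal all of them, and as \<open>n < k\<close> some shift \<open>r\<close> has answer \<open>0\<close>.
  Since a color is left over, a prefix of shift \<open>t + 1\<close> followed by a suffix of shift \<open>t\<close> is
  again repetition-free. Once the agreements with shift \<open>t\<close> are known, such a query counts those
  with shift \<open>t + 1\<close> on a prefix, so each agreement is found by a binary search with
  \<open>\<lceil>log\<^sub>2 n\<rceil>\<close> queries. Starting at \<open>r\<close> and going once around yields the secret after at most
  \<open>k - 1 + n\<lceil>log\<^sub>2 n\<rceil>\<close> queries, and \<open>\<lceil>log\<^sub>2 n\<rceil> \<le> n - 1\<close>.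
\<close>

section \<open>Query budgets for a set \<open>Y\<close> of candidate secrets, and binary search by
  queries\<close>

definition solvable :: "nat \<Rightarrow> nat \<Rightarrow> (nat \<Rightarrow> nat) set \<Rightarrow> nat \<Rightarrow> bool" where
  "solvable n k Y q \<longleftrightarrow>
     (\<exists>s. legal n k s \<and> (\<forall>y\<in>Y. declared n s y = y \<and> num_queries n s y \<le> q))"

lemma solvable_subsingleton:
  assumes "\<And>y y'. y \<in> Y \<Longrightarrow> y' \<in> Y \<Longrightarrow> y = y'"
  shows "solvable n k Y q"
proof -
  have "\<exists>z. Y \<subseteq> {z}" using assms by blast
  then obtain z where "Y \<subseteq> {z}" ..
  then have "legal n k (Identify z) \<and>
      (\<forall>y\<in>Y. declared n (Identify z) y = y \<and> num_queries n (Identify z) y \<le> q)"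
    by auto
  then show ?thesis unfolding solvable_def ..
qed

lemma solvable_mono: "solvable n k Y q \<Longrightarrow> q \<le> q' \<Longrightarrow> solvable n k Y q'"
  unfolding solvable_def by (meson le_trans)

lemma solvable_ask:
  assumes "x \<in> codes n k" and "\<And>b. solvable n k {y \<in> Y. black n x y = b} q"
  shows "solvable n k Y (Suc q)"
proof -
  have "\<exists>s. legal n k s \<and> (\<forall>y\<in>Y. black n x y = b \<longrightarrow>
      declared n s y = y \<and> num_queries n s y \<le> q)" for b
    using assms(2)[of b] unfolding solvable_def by blast
  then obtain f where "\<And>b. legal n k (f b) \<and> (\<forall>y\<in>Y. black n x y = b \<longrightarrow>
      declared n (f b) y = y \<and> num_queries n (f b) y \<le> q)"
    by metis
  then have "legal n k (Ask x f) \<and>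
      (\<forall>y\<in>Y. declared n (Ask x f) y = y \<and> num_queries n (Ask x f) y \<le> Suc q)"
    using assms(1) by auto
  then show ?thesis unfolding solvable_def ..
qed

lemma solvable_ask_many:
  assumes "\<And>j. j < N \<Longrightarrow> x j \<in> codes n k"
    and "\<And>a. solvable n k {y \<in> Y. \<forall>j<N. black n (x j) y = a j} q"
  shows "solvable n k Y (q + N)"
  using assms
proof (induction N arbitrary: Y)
  case 0
  then show ?case by simp
next
  case (Suc N)
  have "solvable n k {y \<in> Y. black n (x N) y = b} (q + N)" for b
  proof (rule Suc.IH)
    show "x j \<in> codes n k" if "j < N" for j using Suc.prems(1) that by simp
    fix a
    \<comment> \<open>Query \<open>N\<close> is asked first, so its answer \<open>b\<close>
      completes the answers \<open>a\<close> of the queries below \<open>N\<close>.\<close>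
    have "{y \<in> {y \<in> Y. black n (x N) y = b}. \<forall>j<N. black n (x j) y = a j} =
        {y \<in> Y. \<forall>j<Suc N. black n (x j) y = (a(N := b)) j}"
      by (auto simp: less_Suc_eq)
    then show "solvable n k {y \<in> {y \<in> Y. black n (x N) y = b}. \<forall>j<N. black n (x j) y = a j} q"
      using Suc.prems(2)[of "a(N := b)"] by simp
  qed
  then show ?case
    using solvable_ask[OF Suc.prems(1)[of N]] by simp
qed

text \<open>The half-open interval from \<open>lo\<close> to \<open>hi\<close> confines
  \<open>f y\<close>, and each query leaves one of two parts of it. \<open>P\<close> is chosen
  before \<open>y\<close>, so the answer alone decides on which side of \<open>l\<close> the value
  lies.\<close>

lemma solvable_binary_search:
  fixes f :: "(nat \<Rightarrow> nat) \<Rightarrow> nat"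
  assumes "\<And>y. y \<in> Y \<Longrightarrow> lo < f y \<and> f y \<le> hi" and "hi - lo \<le> 2 ^ m"
    and "\<And>l. \<exists>x\<in>codes n k. \<exists>P. \<forall>y\<in>Y. f y \<le> l \<longleftrightarrow> P (black n x y)"
    and "\<And>v. solvable n k {y \<in> Y. f y = v} q"
  shows "solvable n k Y (q + m)"
  using assms
proof (induction m arbitrary: Y lo hi)
  case 0
  have "f y = hi" if "y \<in> Y" for y
    using 0(1)[OF that] 0(2) by auto
  then have "{y \<in> Y. f y = hi} = Y" by blast
  then show ?case using 0(4)[of hi] by simp
next
  case (Suc m)
  \<comment> \<open>Not the midpoint: the lower part gets exactly \<open>2 ^ m\<close> values, the
    upper part at most as many. If \<open>mid\<close> exceeds \<open>hi\<close>, the upper part is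
    empty.\<close>
  define mid where "mid = lo + 2 ^ m"
  from Suc.prems(3)[of mid] obtain x P where x: "x \<in> codes n k"
    and P: "\<And>y. y \<in> Y \<Longrightarrow> f y \<le> mid \<longleftrightarrow> P (black n x y)"
    by blast
  have "solvable n k {y \<in> Y. black n x y = b} (q + m)" for b
  proof -
    let ?Y = "{y \<in> Y. black n x y = b}"
    have ask: "\<exists>x\<in>codes n k. \<exists>P. \<forall>y\<in>?Y. f y \<le> l \<longleftrightarrow> P (black n x y)" for l
      using Suc.prems(3)[of l] by blast
    \<comment> \<open>A strategy for a set of candidates also serves every subset.\<close>
    have rest: "solvable n k {y \<in> ?Y. f y = v} q" for v
    proof -
      obtain s where "legal n k s"
        "\<forall>y\<in>{y \<in> Y. f y = v}. declared n s y = y \<and> num_queries n s y \<le> q"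
        using Suc.prems(4)[of v] unfolding solvable_def by blast
      then show ?thesis unfolding solvable_def by blast
    qed
    show ?thesis
    proof (cases "P b")
      case True
      show ?thesis
      proof (rule Suc.IH[OF _ _ ask rest])
        show "lo < f y \<and> f y \<le> mid" if "y \<in> ?Y" for y
          using that P[of y] True Suc.prems(1)[of y] by auto
      qed (simp add: mid_def)
    next
      case False
      show ?thesis
      proof (rule Suc.IH[OF _ _ ask rest])
        show "mid < f y \<and> f y \<le> hi" if "y \<in> ?Y" for y
          using that P[of y] False Suc.prems(1)[of y] by auto
        show "hi - mid \<le> 2 ^ m" using Suc.prems(2) by (simp add: mid_def)
      qed
    qed
  qed
  then show ?case using solvable_ask[OF x] by simp
qed

section \<open>Cyclic shifts, spliced queries and agreement sets\<close>

lemma inj_on_mod_interval: "inj_on (\<lambda>x. x mod k) {a..<a + k}" for k a :: nat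
proof (rule linorder_inj_onI)
  fix x y assume "x < y" "x \<in> {a..<a + k}" "y \<in> {a..<a + k}"
  then have "0 < y - x" "y - x < k" by auto
  then have "\<not> k dvd y - x" by (simp add: nat_dvd_not_less)
  then show "x mod k \<noteq> y mod k"
    using \<open>x < y\<close> mod_eq_dvd_iff_nat[of x y k] by (metis less_imp_le)
qed auto

lemma ex1_mod_interval:
  fixes a c k :: nat
  assumes "c < k"
  shows "\<exists>!x. x \<in> {a..<a + k} \<and> x mod k = c"
proof -
  have "(\<lambda>x. x mod k) ` {a..<a + k} = {..<k}"
    using assms by (intro card_subset_eq) (auto simp: card_image inj_on_mod_interval)
  then have "c \<in> (\<lambda>x. x mod k) ` {a..<a + k}" using assms by simp
  then show ?thesis using inj_on_mod_interval[of k a] by (auto simp: inj_on_def)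
qed

text \<open>Only meant for positions \<open>i \<le> k\<close>, where it is \<open>(j - i) mod k\<close>, moved to \<open>{1..k}\<close>.\<close>

definition shift :: "nat \<Rightarrow> nat \<Rightarrow> nat \<Rightarrow> nat" where
  "shift k j i = Suc ((j + (k - i)) mod k)"

definition agree :: "nat \<Rightarrow> nat \<Rightarrow> nat \<Rightarrow> (nat \<Rightarrow> nat) \<Rightarrow> nat set" where
  "agree n k j y = {i \<in> {1..n}. y i = shift k j i}"

text \<open>The choice \<open>l = 0\<close> gives the plain shift \<open>t\<close>, as in
  \<open>black_spliced_0\<close>.\<close>

definition spliced :: "nat \<Rightarrow> nat \<Rightarrow> nat \<Rightarrow> nat \<Rightarrow> nat \<Rightarrow> nat" where
  "spliced n k t l =
     restrict (\<lambda>i. if i \<le> l then shift k (Suc t) i else shift k t i) {1..n}"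

lemma finite_agree [simp]: "finite (agree n k j y)"
  unfolding agree_def by simp

lemma agree_subset: "agree n k j y \<subseteq> {1..n}"
  unfolding agree_def by auto

text \<open>Shifts are indexed by all naturals, with period \<open>k\<close>. Thus one turn starting
  at \<open>r\<close> is the plain interval \<open>{r..<r + k}\<close>, without wrap-around.\<close>

lemma agree_mod: "agree n k (j mod k) y = agree n k j y"
  unfolding agree_def shift_def by (simp add: mod_add_left_eq)

text \<open>Before reduction mod \<open>k\<close> the entries \<open>g i\<close> strictly decrease
  along the positions, also across the splice. They lie between \<open>t + (k - n)\<close> and
  \<open>t + k\<close>, hence in a window of \<open>k\<close> consecutive numbers because
  \<open>n < k\<close>.\<close>

lemma spliced_in_codes:
  assumes "n < k"
  shows "spliced n k t l \<in> codes n k"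
proof -
  define g where "g i = (if i \<le> l then Suc t else t) + (k - i)" for i
  have sp: "spliced n k t l i = Suc (g i mod k)" if "i \<in> {1..n}" for i
    using that by (simp add: spliced_def shift_def g_def)
  have "inj_on (spliced n k t l) {1..n}"
  proof (rule linorder_inj_onI)
    fix i j assume ij: "i < j" "i \<in> {1..n}" "j \<in> {1..n}"
    then have "g j < g i" using assms by (auto simp: g_def)
    moreover have "g i \<in> {t + (k - n)..<t + (k - n) + k}" "g j \<in> {t + (k - n)..<t + (k - n) + k}"
      using ij assms by (auto simp: g_def)
    ultimately have "g i mod k \<noteq> g j mod k"
      using inj_on_mod_interval[of k "t + (k - n)"] unfolding inj_on_def by (metis less_irrefl)
    then show "spliced n k t l i \<noteq> spliced n k t l j" using ij by (simp add: sp)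
  qed auto
  moreover have "spliced n k t l \<in> {1..n} \<rightarrow>\<^sub>E {1..k}"
  proof (rule PiE_I)
    fix i assume "i \<in> {1..n}"
    then show "spliced n k t l i \<in> {1..k}"
      using assms by (simp add: sp Suc_le_eq)
  qed (auto simp: spliced_def)
  ultimately show ?thesis unfolding codes_def by simp
qed

lemma black_spliced:
  "black n (spliced n k t l) y =
     card (agree n k (Suc t) y \<inter> {..l}) + card (agree n k t y \<inter> {l<..})"
proof -
  have "{i \<in> {1..n}. spliced n k t l i = y i} =
      (agree n k (Suc t) y \<inter> {..l}) \<union> (agree n k t y \<inter> {l<..})"
    by (auto simp: spliced_def agree_def)
  then show ?thesis
    unfolding black_def by (subst card_Un_disjoint[symmetric]) auto
qed

lemma black_spliced_0: "black n (spliced n k t 0) y = card (agree n k t y)"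
proof -
  have "agree n k (Suc t) y \<inter> {..0} = {}" "agree n k t y \<inter> {0<..} = agree n k t y"
    using agree_subset by fastforce+
  then show ?thesis by (simp add: black_spliced)
qed

text \<open>For a fixed position \<open>i\<close>, adding \<open>k - i\<close> carries the window of
  shifts to \<open>k\<close> consecutive numbers, and these meet the residue \<open>y i - 1\<close>
  exactly once.\<close>

lemma ex1_agree:
  assumes "y \<in> codes n k" and "n < k" and "i \<in> {1..n}"
  shows "\<exists>!j. j \<in> {r..<r + k} \<and> i \<in> agree n k j y"
proof -
  have y: "1 \<le> y i" "y i \<le> k" using assms unfolding codes_def by fastforce+
  have iff: "i \<in> agree n k j y \<longleftrightarrow> (j + (k - i)) mod k = y i - 1" for j
    using assms(3) y by (auto simp: agree_def shift_def)
  let ?a = "r + (k - i)"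
  have "\<exists>!x. x \<in> {?a..<?a + k} \<and> x mod k = y i - 1"
    using y by (intro ex1_mod_interval) simp
  then obtain x where x: "x \<in> {?a..<?a + k}" "x mod k = y i - 1"
    and uniq: "\<And>x'. x' \<in> {?a..<?a + k} \<Longrightarrow> x' mod k = y i - 1 \<Longrightarrow> x' = x"
    by blast
  show ?thesis
  proof (rule ex1I[of _ "x - (k - i)"])
    show "x - (k - i) \<in> {r..<r + k} \<and> i \<in> agree n k (x - (k - i)) y"
      using x unfolding iff by auto
    show "j = x - (k - i)" if "j \<in> {r..<r + k} \<and> i \<in> agree n k j y" for j
      using uniq[of "j + (k - i)"] that unfolding iff by auto
  qed
qed

text \<open>By \<open>ex1_agree\<close>, the agreement sets of one full turn partition the
  positions.\<close>

lemma sum_card_agree: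
  assumes "y \<in> codes n k" and "n < k"
  shows "(\<Sum>j\<in>{r..<r + k}. card (agree n k j y)) = n"
proof -
  have "(\<Sum>j\<in>{r..<r + k}. card (agree n k j y)) = card (\<Union>j\<in>{r..<r + k}. agree n k j y)"
  proof (rule card_UN_disjoint[symmetric])
    show "\<forall>j\<in>{r..<r + k}. \<forall>j'\<in>{r..<r + k}. j \<noteq> j' \<longrightarrow> agree n k j y \<inter> agree n k j' y = {}"
    proof (intro ballI impI equals0I)
      fix j j' i
      assume "j \<in> {r..<r + k}" "j' \<in> {r..<r + k}" "j \<noteq> j'"
        "i \<in> agree n k j y \<inter> agree n k j' y"
      moreover from this have "i \<in> {1..n}" using agree_subset by blast
      ultimately show False using ex1_agree[OF assms, of i r] by blast
    qed
  qed auto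
  also have "(\<Union>j\<in>{r..<r + k}. agree n k j y) = {1..n}"
  proof (intro equalityI UN_least agree_subset subsetI)
    fix i assume "i \<in> {1..n}"
    then show "i \<in> (\<Union>j\<in>{r..<r + k}. agree n k j y)"
      using ex1_agree[OF assms, of i r] by blast
  qed
  finally show ?thesis by simp
qed

lemma codes_eqI:
  assumes "y \<in> codes n k" "y' \<in> codes n k" and "n < k"
    and "\<And>j. j \<in> {r..<r + k} \<Longrightarrow> agree n k j y = agree n k j y'"
  shows "y = y'"
proof (rule PiE_ext)
  show "y \<in> {1..n} \<rightarrow>\<^sub>E {1..k}" "y' \<in> {1..n} \<rightarrow>\<^sub>E {1..k}"
    using assms(1,2) unfolding codes_def by auto
  fix i assume "i \<in> {1..n}"
  then obtain j where "j \<in> {r..<r + k}" "i \<in> agree n k j y"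
    using ex1_agree[OF assms(1,3)] by blast
  then have "i \<in> agree n k j y" "i \<in> agree n k j y'" using assms(4) by auto
  then show "y i = y' i" unfolding agree_def by simp
qed

section \<open>Finding the agreements shift by shift\<close>

lemma solvable_next_shift:
  assumes "n < k" and "n \<le> 2 ^ m"
    and "\<And>y. y \<in> Y \<Longrightarrow> agree n k t y = A"
    and "\<And>y. y \<in> Y \<Longrightarrow> B \<subseteq> agree n k (Suc t) y \<and> card (agree n k (Suc t) y) = card B + d"
    and "\<And>C. solvable n k {y \<in> Y. agree n k (Suc t) y = C} q"
  shows "solvable n k Y (q + m * d)"
  using assms(3-)
\<comment> \<open>\<open>B\<close> collects the agreements with shift \<open>Suc t\<close> found so
  far and \<open>d\<close> counts the missing ones. Each round spends \<open>m\<close> queries on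
  one of them and moves it into \<open>B\<close>.\<close>
proof (induction d arbitrary: Y B)
  case 0
  have "agree n k (Suc t) y = B" if "y \<in> Y" for y
    using 0(2)[OF that] card_subset_eq[of "agree n k (Suc t) y" B] by simp
  then have "{y \<in> Y. agree n k (Suc t) y = B} = Y" by blast
  then show ?case using 0(3)[of B] by simp
next
  case (Suc d)
  \<comment> \<open>The least missing agreement is the target, since \<open>f y \<le> l\<close> then
    says that some missing one lies in the prefix up to \<open>l\<close>.\<close>
  define f where "f y = Min (agree n k (Suc t) y - B)" for y
  have f: "f y \<in> agree n k (Suc t) y - B" if "y \<in> Y" for y
  proof -
    have "agree n k (Suc t) y \<noteq> B" using Suc.prems(2)[OF that] by auto
    then show ?thesis
      unfolding f_def using Suc.prems(2)[OF that] by (intro Min_in) auto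
  qed
  have "solvable n k Y ((q + m * d) + m)"
  proof (rule solvable_binary_search)
    show "0 < f y \<and> f y \<le> n" if "y \<in> Y" for y
      using f[OF that] agree_subset[of n k "Suc t" y] by fastforce
    show "n - 0 \<le> 2 ^ m" using assms(2) by simp
    show "\<exists>x\<in>codes n k. \<exists>P. \<forall>y\<in>Y. f y \<le> l \<longleftrightarrow> P (black n x y)" for l
    proof (intro bexI exI ballI)
      show "spliced n k t l \<in> codes n k" using assms(1) by (rule spliced_in_codes)
      fix y assume y: "y \<in> Y"
      let ?S = "agree n k (Suc t) y"
      have sub: "B \<inter> {..l} \<subseteq> ?S \<inter> {..l}" using Suc.prems(2)[OF y] by blast
      have "f y \<le> l \<longleftrightarrow> B \<inter> {..l} \<noteq> ?S \<inter> {..l}"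
      proof
        show "B \<inter> {..l} \<noteq> ?S \<inter> {..l}" if "f y \<le> l" using f[OF y] that by blast
        assume "B \<inter> {..l} \<noteq> ?S \<inter> {..l}"
        then obtain i where "i \<in> ?S - B" "i \<le> l" using sub by blast
        then show "f y \<le> l" unfolding f_def by (meson Min_le finite_Diff finite_agree le_trans)
      qed
      also have "\<dots> \<longleftrightarrow> card (B \<inter> {..l}) < card (?S \<inter> {..l})"
        using sub by (auto intro!: psubset_card_mono)
      \<comment> \<open>The suffix contributes \<open>card (A \<inter> {l<..})\<close> for every
        candidate, so the threshold does not depend on \<open>y\<close>.\<close>
      also have "\<dots> \<longleftrightarrow> card (B \<inter> {..l}) + card (A \<inter> {l<..}) < black n (spliced n k t l) y"
        using Suc.prems(1)[OF y] by (simp add: black_spliced)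
      finally show "f y \<le> l \<longleftrightarrow>
        card (B \<inter> {..l}) + card (A \<inter> {l<..}) < black n (spliced n k t l) y" .
    qed
    show "solvable n k {y \<in> Y. f y = v} (q + m * d)" for v
    proof (rule Suc.IH[where B = "insert v B"])
      fix y assume y: "y \<in> {y \<in> Y. f y = v}"
      show "agree n k t y = A" using y Suc.prems(1) by simp
      have "v \<notin> B" "v \<in> agree n k (Suc t) y" using f[of y] y by auto
      moreover have "finite B" using Suc.prems(2)[of y] y by (auto intro: finite_subset)
      ultimately show "insert v B \<subseteq> agree n k (Suc t) y \<and>
          card (agree n k (Suc t) y) = card (insert v B) + d"
        using Suc.prems(2)[of y] y by simp
    next
      fix C
      show "solvable n k {y \<in> {y \<in> Y. f y = v}. agree n k (Suc t) y = C} q"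
        using Suc.prems(3)[of C] unfolding solvable_def by blast
    qed
  qed
  then show ?case by (simp add: algebra_simps)
qed

text \<open>Shifts \<open>r\<close> to \<open>t\<close> are settled and \<open>d\<close> remain in
  the turn. Since all candidates share the counts \<open>c\<close>, shift \<open>j\<close> costs
  \<open>m * c j\<close> queries. When the turn closes, \<open>codes_eqI\<close> leaves at most one
  candidate.\<close>

lemma solvable_remaining_shifts:
  assumes "n < k" and "n \<le> 2 ^ m" and "Y \<subseteq> codes n k"
    and "\<And>y j. y \<in> Y \<Longrightarrow> card (agree n k j y) = c j"
    and "t + d = r + k - 1" and "r \<le> t"
    and "\<And>y j. y \<in> Y \<Longrightarrow> j \<in> {r..t} \<Longrightarrow> agree n k j y = A j"
  shows "solvable n k Y (m * (\<Sum>j\<in>{t<..<r + k}. c j))"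
  using assms(3-)
proof (induction d arbitrary: t Y A)
  case 0
  then have sub: "{r..<r + k} \<subseteq> {r..t}" by auto
  show ?case
  proof (rule solvable_subsingleton)
    fix y y' assume "y \<in> Y" "y' \<in> Y"
    then show "y = y'"
      using 0(1,5) sub by (intro codes_eqI[OF _ _ \<open>n < k\<close>, of y y' r]) (auto simp: subset_iff)
  qed
next
  case (Suc d)
  have "solvable n k Y (m * (\<Sum>j\<in>{Suc t<..<r + k}. c j) + m * c (Suc t))"
  proof (rule solvable_next_shift[OF assms(1,2)])
    show "agree n k t y = A t" if "y \<in> Y" for y using Suc.prems(4,5) that by simp
    show "{} \<subseteq> agree n k (Suc t) y \<and> card (agree n k (Suc t) y) = card {} + c (Suc t)"
      if "y \<in> Y" for y using Suc.prems(2) that by simp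
    fix C
    show "solvable n k {y \<in> Y. agree n k (Suc t) y = C} (m * (\<Sum>j\<in>{Suc t<..<r + k}. c j))"
      by (rule Suc.IH[where A = "A(Suc t := C)"]) (use Suc.prems in \<open>auto simp: le_Suc_eq\<close>)
  qed
  moreover have "{t<..<r + k} = insert (Suc t) {Suc t<..<r + k}"
    using Suc.prems(3) by auto
  ultimately show ?case by (simp add: algebra_simps)
qed

section \<open>The complete strategy and its cost\<close>

lemma solvable_codes:
  assumes "n < k" and "n \<le> 2 ^ m"
  shows "solvable n k (codes n k) (m * n + (k - 1))"
proof (rule solvable_ask_many[where x = "\<lambda>j. spliced n k j 0"])
  show "spliced n k j 0 \<in> codes n k" for j using assms(1) by (rule spliced_in_codes)
  fix a
  let ?Y = "{y \<in> codes n k. \<forall>j<k - 1. black n (spliced n k j 0) y = a j}"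
  show "solvable n k ?Y (m * n)"
  proof (cases "?Y = {}")
    case True
    then show ?thesis by (intro solvable_subsingleton) auto
  next
    case False
    then obtain y0 where y0: "y0 \<in> ?Y" by blast
    define c where "c j = card (agree n k j y0)" for j
    have c_sum: "(\<Sum>j\<in>{r..<r + k}. c j) = n" for r
      unfolding c_def using y0 assms(1) by (intro sum_card_agree) auto
    \<comment> \<open>The answers fix the counts below \<open>k - 1\<close>, the total
      \<open>n\<close> fixes the one at \<open>k - 1\<close>, and periodicity extends this to all
      \<open>j\<close>. So the counts of \<open>y0\<close> are those of every candidate.\<close>
    have c: "card (agree n k j y) = c j" if y: "y \<in> ?Y" for y j
    proof -
      have less: "card (agree n k i y) = c i" if "i < k - 1" for i
        using y y0 that by (simp add: black_spliced_0 c_def)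
      have split: "(\<Sum>i\<in>{0..<0 + k}. g i) = (\<Sum>i<k - 1. g i) + g (k - 1)" for g :: "nat \<Rightarrow> nat"
        using assms(1) by (cases k) (auto simp: atLeast0LessThan)
      have "(\<Sum>i\<in>{0..<0 + k}. card (agree n k i y)) = (\<Sum>i\<in>{0..<0 + k}. c i)"
        using sum_card_agree[of y n k 0] c_sum[of 0] y assms(1) by simp
      then have "card (agree n k (k - 1) y) = c (k - 1)"
        unfolding split using less by simp
      moreover have "j mod k < k - 1 \<or> j mod k = k - 1"
        using mod_less_divisor[of k j] assms(1) by linarith
      ultimately have "card (agree n k (j mod k) y) = c (j mod k)"
        using less[of "j mod k"] by auto
      then show ?thesis by (simp add: agree_mod c_def)
    qed
    have "\<exists>r. c r = 0"
    proof (rule ccontr)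
      assume "\<nexists>r. c r = 0"
      then have "(\<Sum>j\<in>{0..<0 + k}. 1) \<le> (\<Sum>j\<in>{0..<0 + k}. c j)"
        by (intro sum_mono) (simp add: Suc_le_eq)
      then show False using c_sum[of 0] assms(1) by simp
    qed
    then obtain r where r: "c r = 0" ..
    have "solvable n k ?Y (m * (\<Sum>j\<in>{r<..<r + k}. c j))"
    \<comment> \<open>A zero count means that the agreement set of shift \<open>r\<close> is known
      to be empty; this provides the settled shift from which the turn starts.\<close>
    proof (rule solvable_remaining_shifts[where d = "k - 1" and A = "\<lambda>_. {}", OF assms])
      show "agree n k j y = {}" if "y \<in> ?Y" "j \<in> {r..r}" for y j
        using c[OF that(1), of r] that(2) r by simp
    qed (use assms(1) c in auto)
    moreover have "(\<Sum>j\<in>{r<..<r + k}. c j) \<le> n"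
      unfolding c_sum[of r, symmetric] by (intro sum_mono2) auto
    ultimately show ?thesis by (rule solvable_mono[OF _ mult_le_mono2])
  qed
qed

theorem theorem1:
  fixes n k :: nat
  assumes "n \<ge> 1" and "k > n"
  shows "\<exists>s. legal n k s \<and>
    (\<forall>y \<in> codes n k. declared n s y = y \<and>
      int (num_queries n s y) \<le> (int n - 1) * \<lceil>log 2 (real n)\<rceil> + int k + int n - 2)"
proof -
  define m where "m = nat \<lceil>log 2 (real n)\<rceil>"
  have "0 \<le> log 2 (real n)" using assms(1) by simp
  then have m: "int m = \<lceil>log 2 (real n)\<rceil>" unfolding m_def by simp
  have "log 2 (real n) \<le> real m" using m by linarith
  then have "real n \<le> 2 powr real m" using assms(1) by (simp add: log_le_iff)
  then have "real n \<le> real (2 ^ m)" by (simp add: powr_realpow)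
  then have n: "n \<le> 2 ^ m" by (simp only: of_nat_le_iff)
  \<comment> \<open>This yields \<open>m \<le> n - 1\<close>, which turns
    \<open>m * n + (k - 1)\<close> into the required bound: one of the \<open>n\<close> summands
    \<open>m\<close> is replaced by \<open>n - 1\<close>.\<close>
  have "n \<le> 2 ^ (n - 1)" using assms(1) less_exp[of "n - 1"] by linarith
  then have "real n \<le> 2 powr real (n - 1)"
    by (metis of_nat_le_iff of_nat_numeral of_nat_power powr_realpow zero_less_numeral)
  then have "log 2 (real n) \<le> real (n - 1)" using assms(1) by (simp add: log_le_iff)
  then have "\<lceil>log 2 (real n)\<rceil> \<le> int (n - 1)" by (simp add: ceiling_le_iff)
  then have "int m \<le> int n - 1" using m assms(1) by simp
  then have bound: "int (m * n + (k - 1)) \<le> (int n - 1) * int m + int k + int n - 2"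
    using assms by (simp add: algebra_simps of_nat_diff)
  obtain s where "legal n k s" and
    "\<forall>y\<in>codes n k. declared n s y = y \<and> num_queries n s y \<le> m * n + (k - 1)"
    using solvable_codes[OF assms(2) n] unfolding solvable_def by blast
  then show ?thesis using bound unfolding m[symmetric] by (meson of_nat_le_iff order_trans)
qed

end
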